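(* Let $h$ be a combinatorial presheaf. For all $a,b\in\mathcal G(h)$ the pattern functions satisfy $$\mathrm{p}_a\,\mathrm{p}_b=\sum_{c\in\mathcal G(h)}\binom{c}{a,b}\mathrm{p}_c$$ (pointwise product of functions $\mathcal G(h)\to\mathbb Q$, the sum having finitely many nonzero terms on each argument). In particular $\mathcal A(h)$ is a subalgebra of the algebra of functions $\mathcal G(h)\to\mathbb Q$ with pointwise multiplication, with unit $\sum_{c\in h[\emptyset]}\mathrm{p}_c$.
   Context: A combinatorial presheaf $h$ is a contravariant functor from the category of finite sets with injections to the category of finite sets: for each finite set $I$ a finite set $h[I]$, and for each injection $f:J\to I$ a map $h[f]:h[I]\to h[J]$, functorially. For $J\subseteq I$, $a|_J$ denotes the image of $a\in h[I]$ under the map induced by the inclusion. Objects $a\in h[I]$, $b\in h[J]$ are isomorphic ($a\sim b$) if some bijection $f:I\to J$ has $h[f](b)=a$. The set of coinvariants is $\mathcal G(h)=\biguplus_{n\ge0}h[[n]]/\sim$ with $[n]=\{1,\dots,n\}$. For objects $a$ and $b\in h[I]$, $\mathrm{p}_a(b)=|\{J'\subseteq I: b|_{J'}\sim a\}|$; this depends only on the isomorphism classes, so $\mathrm{p}_a$ for $a\in\mathcal G(h)$ is a function $\mathcal G(h)\to\mathbb Q$. $\mathcal A(h)$ is the $\mathbb Q$-linear span of $\{\mathrm{p}_a:a\in\mathcal G(h)\}$. For objects $a,b$ and $c\in h[C]$, the quasi-shuffle number is $\binom{c}{a,b}=|\{(I,J): I\cup J=C,\ c|_I\sim a,\ c|_J\sim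 b\}|$, which depends only on the isomorphism classes. *)

theory Defs
  imports "HOL-Algebra.Algebraic_Closure_Type"
begin

(* Finite sets are finite subsets of nat: this full subcategory contains every [n] = {1..n}
   and all subsets of [n], and is equivalent to the category of all finite sets with
   injections.  A morphism J -> I is an injection in the extensional function space, so that
   morphisms are determined by their values on J. *)

definition injections :: "nat set \<Rightarrow> nat set \<Rightarrow> (nat \<Rightarrow> nat) set" where
  "injections J I = {f \<in> J \<rightarrow>\<^sub>E I. inj_on f J}"

(* "mor h J I f" is the map h[f] : h[I] -> h[J] induced by the injection f : J -> I. *)

record 'a presheaf =
  ob :: "nat set \<Rightarrow> 'a set"
  mor :: "nat set \<Rightarrow> nat set \<Rightarrow> (nat \<Rightarrow> nat) \<Rightarrow> 'a \<Rightarrow> 'a"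

locale combinatorial_presheaf =
  fixes h :: "'a presheaf"
  assumes finite_ob: "finite I \<Longrightarrow> finite (ob h I)"
    and mor_closed: "\<lbrakk>finite I; finite J; f \<in> injections J I; a \<in> ob h I\<rbrakk>
          \<Longrightarrow> mor h J I f a \<in> ob h J"
    and mor_id: "\<lbrakk>finite I; a \<in> ob h I\<rbrakk> \<Longrightarrow> mor h I I (\<lambda>i\<in>I. i) a = a"
    and mor_comp: "\<lbrakk>finite I; finite J; finite K; f \<in> injections J I; g \<in> injections K J;
          a \<in> ob h I\<rbrakk> \<Longrightarrow> mor h K I (compose K f g) a = mor h K J g (mor h J I f a)"

(* An object is a pair (I, a) with a in h[I]; the carriers h[I] need not be disjoint. *)

type_synonym 'a object = "nat set \<times> 'a"

definition objects :: "'a presheaf \<Rightarrow> 'a object set" where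
  "objects h = {(I, a). finite I \<and> a \<in> ob h I}"

definition restr :: "'a presheaf \<Rightarrow> 'a object \<Rightarrow> nat set \<Rightarrow> 'a object" where
  "restr h b J = (J, mor h J (fst b) (\<lambda>j\<in>J. j) (snd b))"

definition iso_objects :: "'a presheaf \<Rightarrow> 'a object \<Rightarrow> 'a object \<Rightarrow> bool" where
  "iso_objects h a b \<longleftrightarrow>
     (\<exists>f \<in> fst a \<rightarrow>\<^sub>E fst b. bij_betw f (fst a) (fst b) \<and> mor h (fst a) (fst b) f (snd b) = snd a)"

definition objects_on :: "'a presheaf \<Rightarrow> nat \<Rightarrow> 'a object set" where
  "objects_on h n = {{1..n}} \<times> ob h {1..n}"

definition iso_rel :: "'a presheaf \<Rightarrow> nat \<Rightarrow> ('a object \<times> 'a object) set" where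
  "iso_rel h n = {(a, b). a \<in> objects_on h n \<and> b \<in> objects_on h n \<and> iso_objects h a b}"

(* The union over n is disjoint, since objects carry their underlying set. *)

definition coinvariants :: "'a presheaf \<Rightarrow> 'a object set set" where
  "coinvariants h = (\<Union>n. objects_on h n // iso_rel h n)"

definition pattern_count :: "'a presheaf \<Rightarrow> 'a object \<Rightarrow> 'a object \<Rightarrow> nat" where
  "pattern_count h a b = card {J. J \<subseteq> fst b \<and> iso_objects h (restr h b J) a}"

definition quasi_shuffle :: "'a presheaf \<Rightarrow> 'a object \<Rightarrow> 'a object \<Rightarrow> 'a object \<Rightarrow> nat" where
  "quasi_shuffle h c a b =
     card {(I, J). I \<union> J = fst c \<and> iso_objects h (restr h c I) a \<and> iso_objects h (restr h c J) b}"

(* The two numbers on isomorphism classes are computed on representatives; they do not depend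
   on the choice, see pattern_fun_eq and quasi_shuffle_class_eq below. *)

definition rep :: "'a object set \<Rightarrow> 'a object" where
  "rep A = (SOME a. a \<in> A)"

definition quasi_shuffle_class ::
    "'a presheaf \<Rightarrow> 'a object set \<Rightarrow> 'a object set \<Rightarrow> 'a object set \<Rightarrow> nat" where
  "quasi_shuffle_class h C A B = quasi_shuffle h (rep C) (rep A) (rep B)"

definition pattern_fun :: "'a presheaf \<Rightarrow> 'a object set \<Rightarrow> 'a object set \<Rightarrow> rat" where
  "pattern_fun h A = (\<lambda>B\<in>coinvariants h. of_nat (pattern_count h (rep A) (rep B)))"

abbreviation rat_field :: "rat ring" where
  "rat_field \<equiv> ring_of_type_algebra"

(* The algebra of functions D -> rat with pointwise operations; functions are extensional. *)

definition fun_algebra :: "'x set \<Rightarrow> (rat, 'x \<Rightarrow> rat) module" where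
  "fun_algebra D =
     \<lparr>carrier = D \<rightarrow>\<^sub>E UNIV,
      monoid.mult = (\<lambda>f g. \<lambda>x\<in>D. f x * g x),
      one = (\<lambda>x\<in>D. 1),
      ring.zero = (\<lambda>x\<in>D. 0),
      add = (\<lambda>f g. \<lambda>x\<in>D. f x + g x),
      module.smult = (\<lambda>q f. \<lambda>x\<in>D. q * f x)\<rparr>"

definition linear_span :: "('r, 'x) ring_scheme \<Rightarrow> ('r, 'm, 'y) module_scheme \<Rightarrow> 'm set \<Rightarrow> 'm set" where
  "linear_span R M B =
     {finsum M (\<lambda>v. q v \<odot>\<^bsub>M\<^esub> v) S | q S. finite S \<and> S \<subseteq> B \<and> q \<in> S \<rightarrow> carrier R}"

definition pattern_algebra :: "'a presheaf \<Rightarrow> ('a object set \<Rightarrow> rat) set" where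
  "pattern_algebra h =
     linear_span rat_field (fun_algebra (coinvariants h)) (pattern_fun h ` coinvariants h)"

(* Unital subalgebra of a commutative algebra: the unit of M lies in A (part of subring). *)

definition unital_subalgebra ::
    "'m set \<Rightarrow> ('r, 'x) ring_scheme \<Rightarrow> ('r, 'm, 'y) module_scheme \<Rightarrow> bool" where
  "unital_subalgebra A R M \<longleftrightarrow> algebra R M \<and> submodule A R M \<and> subring A M"

(* The class of an element of h[empty set] = h[[0]]. *)

definition empty_class :: "'a presheaf \<Rightarrow> 'a \<Rightarrow> 'a object set" where
  "empty_class h c = iso_rel h 0 `` {({}, c)}"


context combinatorial_presheaf
begin

lemma inclusion_in_injections: "J \<subseteq> I \<Longrightarrow> (\<lambda>j\<in>J. j) \<in> injections J I"
  by (auto simp: injections_def inj_on_def)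

lemma restr_in_objects:
  assumes "b \<in> objects h" "J \<subseteq> fst b" shows "restr h b J \<in> objects h"
  using assms inclusion_in_injections[of J "fst b"] finite_subset[of J "fst b"]
  by (auto simp: objects_def restr_def intro!: mor_closed)

lemma iso_refl: "a \<in> objects h \<Longrightarrow> iso_objects h a a"
  unfolding iso_objects_def objects_def
  by (intro bexI[of _ "\<lambda>i\<in>fst a. i"]) (auto simp: mor_id bij_betw_def inj_on_def)

lemma iso_sym:
  assumes "a \<in> objects h" "b \<in> objects h" "iso_objects h a b"
  shows "iso_objects h b a"
proof -
  obtain I x J y where ab: "a = (I, x)" "b = (J, y)" by (cases a, cases b) auto
  have fin: "finite I" "finite J" "x \<in> ob h I" "y \<in> ob h J"
    using assms ab by (auto simp: objects_def)
  obtain f where f: "f \<in> I \<rightarrow>\<^sub>E J" "bij_betw f I J" "mor h I J f y = x"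
    using assms(3) ab by (auto simp: iso_objects_def)
  define g where "g = (\<lambda>j\<in>J. inv_into I f j)"
  have g: "bij_betw g J I"
    using bij_betw_inv_into[OF f(2)] by (simp add: g_def bij_betw_def inj_on_def)
  have gE: "g \<in> J \<rightarrow>\<^sub>E I" using g by (auto simp: g_def bij_betw_def)
  have comp: "compose J f g = (\<lambda>j\<in>J. j)"
    using f(2) by (auto simp: compose_def g_def bij_betw_def f_inv_into_f intro!: restrict_ext)
  have "mor h J I g (mor h I J f y) = mor h J J (compose J f g) y"
    using fin f(1,2) g gE by (intro mor_comp[symmetric]) (auto simp: injections_def bij_betw_def)
  also have "\<dots> = y" using comp fin by (simp add: mor_id)
  finally show ?thesis using g gE f(3) ab by (auto simp: iso_objects_def)
qed

lemma iso_trans: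
  assumes "a \<in> objects h" "b \<in> objects h" "c \<in> objects h"
    and "iso_objects h a b" "iso_objects h b c"
  shows "iso_objects h a c"
proof -
  obtain I x J y K z where abc: "a = (I, x)" "b = (J, y)" "c = (K, z)"
    by (cases a, cases b, cases c) auto
  have fin: "finite I" "finite J" "finite K" "z \<in> ob h K"
    using assms abc by (auto simp: objects_def)
  obtain f where f: "f \<in> I \<rightarrow>\<^sub>E J" "bij_betw f I J" "mor h I J f y = x"
    using assms(4) abc by (auto simp: iso_objects_def)
  obtain g where g: "g \<in> J \<rightarrow>\<^sub>E K" "bij_betw g J K" "mor h J K g z = y"
    using assms(5) abc by (auto simp: iso_objects_def)
  have "mor h I K (compose I g f) z = mor h I J f (mor h J K g z)"
    using fin f g by (intro mor_comp) (auto simp: injections_def bij_betw_def)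
  moreover have "bij_betw (compose I g f) I K" using f(2) g(2) by (rule bij_betw_compose)
  moreover have "compose I g f \<in> I \<rightarrow>\<^sub>E K" using f(1) g(1) by (auto simp: compose_def)
  ultimately show ?thesis using f(3) g(3) abc by (auto simp: iso_objects_def)
qed

lemma objects_on_subset: "objects_on h n \<subseteq> objects h"
  by (auto simp: objects_on_def objects_def)

lemma equiv_iso_rel: "equiv (objects_on h n) (iso_rel h n)"
  using objects_on_subset[of n]
  by (auto simp: equiv_def refl_on_def sym_def trans_def iso_rel_def
      intro: iso_refl iso_sym iso_trans)

lemma rep_in:
  assumes "A \<in> coinvariants h" shows "rep A \<in> A"
proof -
  obtain n where "A \<in> objects_on h n // iso_rel h n" using assms by (auto simp: coinvariants_def)
  hence "A \<noteq> {}" by (rule in_quotient_imp_non_empty[OF equiv_iso_rel])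
  thus ?thesis unfolding rep_def by (simp add: some_in_eq)
qed

lemma class_members:
  assumes "A \<in> coinvariants h" "a \<in> A" "a' \<in> A"
  shows "a \<in> objects h" "a' \<in> objects h" "iso_objects h a a'"
proof -
  obtain n where A: "A \<in> objects_on h n // iso_rel h n" using assms by (auto simp: coinvariants_def)
  have "(a, a') \<in> iso_rel h n"
    using quotient_eq_iff[OF equiv_iso_rel A A assms(2,3)] by simp
  thus "a \<in> objects h" "a' \<in> objects h" "iso_objects h a a'"
    using objects_on_subset[of n] by (auto simp: iso_rel_def)
qed

lemma iso_restr:
  assumes "b \<in> objects h" "b' \<in> objects h" "f \<in> fst b \<rightarrow>\<^sub>E fst b'"
    and "bij_betw f (fst b) (fst b')" "mor h (fst b) (fst b') f (snd b') = snd b"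
    and "J \<subseteq> fst b"
  shows "iso_objects h (restr h b J) (restr h b' (f ` J))"
proof -
  let ?I = "fst b" and ?I' = "fst b'"
  have "finite ?I" "finite ?I'" "snd b' \<in> ob h ?I'" using assms by (auto simp: objects_def)
  hence fin: "finite ?I" "finite ?I'" "finite J" "finite (f ` J)" "snd b' \<in> ob h ?I'"
    using finite_subset[OF assms(6)] by auto
  have sub: "f ` J \<subseteq> ?I'" using assms by auto
  have injJ: "inj_on f J" using assms by (meson bij_betw_def inj_on_subset)
  define g where "g = restrict f J"
  have gE: "g \<in> J \<rightarrow>\<^sub>E f ` J" by (auto simp: g_def)
  have gb: "bij_betw g J (f ` J)" using injJ by (auto simp: g_def bij_betw_def inj_on_def)
  have "mor h J (f ` J) g (mor h (f ` J) ?I' (\<lambda>j\<in>f ` J. j) (snd b'))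
      = mor h J ?I' (compose J (\<lambda>j\<in>f ` J. j) g) (snd b')"
    using fin sub gE gb inclusion_in_injections[OF sub]
    by (intro mor_comp[symmetric]) (auto simp: injections_def bij_betw_def)
  also have "compose J (\<lambda>j\<in>f ` J. j) g = compose J f (\<lambda>j\<in>J. j)"
    by (auto simp: compose_def g_def)
  also have "mor h J ?I' \<dots> (snd b') = mor h J ?I (\<lambda>j\<in>J. j) (mor h ?I ?I' f (snd b'))"
    using fin assms inclusion_in_injections[OF assms(6)]
    by (intro mor_comp) (auto simp: injections_def bij_betw_def)
  finally have "mor h J (f ` J) g (mor h (f ` J) ?I' (\<lambda>j\<in>f ` J. j) (snd b'))
      = mor h J ?I (\<lambda>j\<in>J. j) (snd b)"
    unfolding assms(5) .
  thus ?thesis unfolding iso_objects_def restr_def fst_conv snd_conv using gE gb by blast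
qed

lemma iso_restr_iff:
  assumes "b \<in> objects h" "b' \<in> objects h" "f \<in> fst b \<rightarrow>\<^sub>E fst b'"
    and "bij_betw f (fst b) (fst b')" "mor h (fst b) (fst b') f (snd b') = snd b"
    and "J \<subseteq> fst b" and "a \<in> objects h" "a' \<in> objects h" "iso_objects h a a'"
  shows "iso_objects h (restr h b J) a \<longleftrightarrow> iso_objects h (restr h b' (f ` J)) a'"
proof -
  have "f ` J \<subseteq> fst b'" using assms by auto
  with assms have o: "restr h b J \<in> objects h" "restr h b' (f ` J) \<in> objects h"
    by (auto intro: restr_in_objects)
  show ?thesis
    using o assms(7-9) iso_restr[OF assms(1-6)] iso_sym iso_trans by meson
qed

lemma pattern_count_cong:
  assumes "a \<in> objects h" "a' \<in> objects h" "iso_objects h a a'"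
    and "b \<in> objects h" "b' \<in> objects h" "iso_objects h b b'"
  shows "pattern_count h a b = pattern_count h a' b'"
proof -
  obtain f where f: "f \<in> fst b \<rightarrow>\<^sub>E fst b'" "bij_betw f (fst b) (fst b')"
      "mor h (fst b) (fst b') f (snd b') = snd b"
    using assms(6) by (auto simp: iso_objects_def)
  note iff = iso_restr_iff[OF assms(4,5) f _ assms(1-3)]
  let ?A = "{J. J \<subseteq> fst b \<and> iso_objects h (restr h b J) a}"
  let ?B = "{J. J \<subseteq> fst b' \<and> iso_objects h (restr h b' J) a'}"
  have inj: "inj_on (image f) (Pow (fst b))" "f ` fst b = fst b'"
    using f(2) bij_betw_Pow[OF f(2)] by (auto simp: bij_betw_def)
  have "inj_on (image f) ?A" using inj(1) by (rule inj_on_subset) auto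
  moreover have "image f ` ?A = ?B"
  proof (intro equalityI subsetI)
    fix K assume K: "K \<in> ?B"
    hence "K \<subseteq> f ` fst b" using inj(2) by simp
    then obtain J where "J \<subseteq> fst b" "K = f ` J" by (rule subset_imageE)
    with K iff show "K \<in> image f ` ?A" by auto
  next
    fix K assume "K \<in> image f ` ?A"
    then obtain J where "J \<subseteq> fst b" "iso_objects h (restr h b J) a" "K = f ` J" by auto
    with iff inj(2) show "K \<in> ?B" by auto
  qed
  ultimately have "bij_betw (image f) ?A ?B" by (simp add: bij_betw_def)
  thus ?thesis unfolding pattern_count_def by (rule bij_betw_same_card)
qed

lemma quasi_shuffle_cong:
  assumes "a \<in> objects h" "a' \<in> objects h" "iso_objects h a a'"
    and "b \<in> objects h" "b' \<in> objects h" "iso_objects h b b'"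
    and "c \<in> objects h" "c' \<in> objects h" "iso_objects h c c'"
  shows "quasi_shuffle h c a b = quasi_shuffle h c' a' b'"
proof -
  obtain f where f: "f \<in> fst c \<rightarrow>\<^sub>E fst c'" "bij_betw f (fst c) (fst c')"
      "mor h (fst c) (fst c') f (snd c') = snd c"
    using assms(9) by (auto simp: iso_objects_def)
  note iffa = iso_restr_iff[OF assms(7,8) f _ assms(1-3)]
  note iffb = iso_restr_iff[OF assms(7,8) f _ assms(4-6)]
  let ?A = "{(I, J). I \<union> J = fst c \<and> iso_objects h (restr h c I) a \<and> iso_objects h (restr h c J) b}"
  let ?B = "{(I, J). I \<union> J = fst c' \<and> iso_objects h (restr h c' I) a' \<and> iso_objects h (restr h c' J) b'}"
  let ?F = "map_prod (image f) (image f)"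
  have inj: "inj_on (image f) (Pow (fst c))" "f ` fst c = fst c'"
    using f(2) bij_betw_Pow[OF f(2)] by (auto simp: bij_betw_def)
  have "inj_on ?F (Pow (fst c) \<times> Pow (fst c))" using inj(1) by (intro map_prod_inj_on)
  hence "inj_on ?F ?A" by (rule inj_on_subset) auto
  moreover have "?F ` ?A = ?B"
  proof (intro equalityI subsetI)
    fix p assume "p \<in> ?F ` ?A"
    then obtain I J where p: "p = (f ` I, f ` J)" "I \<union> J = fst c"
        "iso_objects h (restr h c I) a" "iso_objects h (restr h c J) b" by auto
    moreover have "f ` I \<union> f ` J = fst c'" using p(2) inj(2) by (metis image_Un)
    moreover have "I \<subseteq> fst c" "J \<subseteq> fst c" using p(2) by auto
    ultimately show "p \<in> ?B" using iffa iffb by auto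
  next
    fix p assume "p \<in> ?B"
    then obtain K L where p: "p = (K, L)" "K \<union> L = fst c'"
        "iso_objects h (restr h c' K) a'" "iso_objects h (restr h c' L) b'" by auto
    have "K \<subseteq> f ` fst c" "L \<subseteq> f ` fst c" using p(2) inj(2) by auto
    then obtain I J where IJ: "I \<subseteq> fst c" "J \<subseteq> fst c" "K = f ` I" "L = f ` J"
      by (meson subset_imageE)
    have "f ` (I \<union> J) = f ` fst c" using p(2) IJ inj(2) by auto
    hence "I \<union> J = fst c" by (rule inj_onD[OF inj(1)]) (use IJ in auto)
    hence "(I, J) \<in> ?A" using IJ p(3,4) iffa iffb by auto
    thus "p \<in> ?F ` ?A" using IJ p(1) by force
  qed
  ultimately have "bij_betw ?F ?A ?B" by (simp add: bij_betw_def)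
  thus ?thesis unfolding quasi_shuffle_def by (rule bij_betw_same_card)
qed

lemma pattern_fun_eq:
  assumes "A \<in> coinvariants h" "B \<in> coinvariants h" "a \<in> A" "b \<in> B"
  shows "pattern_fun h A B = of_nat (pattern_count h a b)"
  using assms class_members[OF assms(1) rep_in assms(3)] class_members[OF assms(2) rep_in assms(4)]
  by (simp add: pattern_fun_def pattern_count_cong[of "rep A" a "rep B" b])

lemma quasi_shuffle_class_eq:
  assumes "A \<in> coinvariants h" "B \<in> coinvariants h" "C \<in> coinvariants h" "a \<in> A" "b \<in> B" "c \<in> C"
  shows "quasi_shuffle_class h C A B = quasi_shuffle h c a b"
  unfolding quasi_shuffle_class_def
  by (intro quasi_shuffle_cong class_members[OF assms(1) rep_in assms(4)]
      class_members[OF assms(2) rep_in assms(5)] class_members[OF assms(3) rep_in assms(6)] assms)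

end

end

theory Submission
  imports Defs
begin

text \<open>Fix an object d and count in two ways the pairs (I, J) of subsets of its underlying set
  such that d restricted to I is isomorphic to a and d restricted to J is isomorphic to b. There are
  p_a(d) p_b(d) of them. On the other hand, sort them by the union K of I and J: since restricting
  in two stages is restricting at once, the pairs over K are the quasi-shuffles of a and b in the
  restriction of d to K (\<open>pattern_count_mult\<close>). Their number depends only on the class
  of that restriction, and a class c arises from p_c(d) subsets K; grouping the K by class gives the
  formula (\<open>quasi_shuffle_product_count\<close>).

  For the span to be closed under products, the formula must be a finite linear combination that
  does not depend on the argument. If c has a nonzero quasi-shuffle number, its underlying set is
  covered by a copy of a and a copy of b, so its size is bounded, and only finitely many classes
  have bounded size (\<open>finite_quasi_shuffle_support\<close>). Closure then passes from
  generators to the span by bilinearity (\<open>linear_span_mult_closed\<close>). The unit is in the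
  span because each object restricts to exactly one element over the empty set
  (\<open>sum_pattern_count_empty\<close>).\<close>

section \<open>Linear spans in modules\<close>

lemma submodule_finsum_closed:
  assumes "module R M" "submodule N R M" "finite S" "f \<in> S \<rightarrow> N"
  shows "finsum M f S \<in> N"
proof -
  interpret module R M by fact
  interpret N: submodule N R M by fact
  have N: "N \<subseteq> carrier M" using N.subset by simp
  show ?thesis using assms(3,4)
  proof (induction S rule: finite_induct)
    case empty
    then show ?case using N.one_closed by simp
  next
    case (insert x S)
    then have "f \<in> S \<rightarrow> carrier M" "f x \<in> carrier M" using N by auto
    with insert show ?case using N.m_closed[of "f x" "finsum M f S"] by simp
  qed
qed

context module
begin

lemma linear_span_memI:
  assumes "B \<subseteq> carrier M" "v \<in> B"
  shows "v \<in> linear_span R M B"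
proof -
  have "finsum M (\<lambda>w. \<one> \<odot>\<^bsub>M\<^esub> w) {v} = v"
    using assms by (subst finsum_insert) auto
  then show ?thesis
    unfolding linear_span_def using assms
    by (intro CollectI exI[of _ "\<lambda>_. \<one>"] exI[of _ "{v}"]) auto
qed

text \<open>Minimality of the span: a linear condition that holds on generators holds on all of the
  span.\<close>

lemma linear_span_subset_submodule:
  assumes "submodule N R M" "B \<subseteq> N"
  shows "linear_span R M B \<subseteq> N"
proof -
  interpret N: submodule N R M by fact
  show ?thesis
    using assms by (auto simp: linear_span_def intro!: submodule_finsum_closed module_axioms N.smult_closed)
qed

lemma submodule_linear_span:
  assumes B: "B \<subseteq> carrier M"
  shows "submodule (linear_span R M B) R M"
proof (rule module.submoduleI[OF module_axioms])
  show sub: "linear_span R M B \<subseteq> carrier M"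
    using B by (auto simp: linear_span_def intro!: finsum_closed smult_closed)
  show "\<zero>\<^bsub>M\<^esub> \<in> linear_span R M B"
    unfolding linear_span_def by (intro CollectI exI[of _ "\<lambda>_. \<zero>"] exI[of _ "{}"]) auto
  show smult: "a \<odot>\<^bsub>M\<^esub> x \<in> linear_span R M B" if "a \<in> carrier R" "x \<in> linear_span R M B" for a x
  proof -
    obtain q S where S: "finite S" "S \<subseteq> B" "q \<in> S \<rightarrow> carrier R" "x = finsum M (\<lambda>v. q v \<odot>\<^bsub>M\<^esub> v) S"
      using \<open>x \<in> linear_span R M B\<close> by (auto simp: linear_span_def)
    have "a \<odot>\<^bsub>M\<^esub> x = finsum M (\<lambda>v. a \<odot>\<^bsub>M\<^esub> (q v \<odot>\<^bsub>M\<^esub> v)) S"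
      unfolding S(4) using S B that by (intro finsum_smult_ldistr) auto
    also have "\<dots> = finsum M (\<lambda>v. (a \<otimes> q v) \<odot>\<^bsub>M\<^esub> v) S"
      using S B that by (intro finsum_cong') (auto simp: smult_assoc1 Pi_iff subset_iff)
    finally show ?thesis
      unfolding linear_span_def using S that
      by (intro CollectI exI[of _ "\<lambda>v. a \<otimes> q v"] exI[of _ S]) auto
  qed
  show "\<ominus>\<^bsub>M\<^esub> x \<in> linear_span R M B" if "x \<in> linear_span R M B" for x
    using smult[of "\<ominus> \<one>" x] sub that by (auto simp: smult_l_minus subset_iff)
  show "x \<oplus>\<^bsub>M\<^esub> y \<in> linear_span R M B"
    if "x \<in> linear_span R M B" "y \<in> linear_span R M B" for x y
  proof -
    obtain q S where S: "finite S" "S \<subseteq> B" "q \<in> S \<rightarrow> carrier R" "x = finsum M (\<lambda>v. q v \<odot>\<^bsub>M\<^esub> v) S"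
      using \<open>x \<in> linear_span R M B\<close> by (auto simp: linear_span_def)
    obtain r T where T: "finite T" "T \<subseteq> B" "r \<in> T \<rightarrow> carrier R" "y = finsum M (\<lambda>v. r v \<odot>\<^bsub>M\<^esub> v) T"
      using \<open>y \<in> linear_span R M B\<close> by (auto simp: linear_span_def)
    \<comment> \<open>Extending both coefficient families by zero puts the two combinations on the
      common index set \<open>S \<union> T\<close>.\<close>
    define q' r' where "q' v = (if v \<in> S then q v else \<zero>)" and "r' v = (if v \<in> T then r v else \<zero>)" for v
    have q'[simp]: "q' v \<in> carrier R" and r'[simp]: "r' v \<in> carrier R" for v
      using S T by (auto simp: q'_def r'_def)
    have BM: "v \<in> carrier M" if "v \<in> S \<union> T" for v using that S T B by auto
    have "x = finsum M (\<lambda>v. q' v \<odot>\<^bsub>M\<^esub> v) (S \<union> T)"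
      unfolding S(4) using S T BM
      by (intro add.finprod_mono_neutral_cong_left) (auto simp: q'_def Pi_iff)
    moreover have "y = finsum M (\<lambda>v. r' v \<odot>\<^bsub>M\<^esub> v) (S \<union> T)"
      unfolding T(4) using S T BM
      by (intro add.finprod_mono_neutral_cong_left) (auto simp: r'_def Pi_iff)
    ultimately have "x \<oplus>\<^bsub>M\<^esub> y = finsum M (\<lambda>v. q' v \<odot>\<^bsub>M\<^esub> v \<oplus>\<^bsub>M\<^esub> r' v \<odot>\<^bsub>M\<^esub> v) (S \<union> T)"
      using BM by (simp add: finsum_addf)
    also have "\<dots> = finsum M (\<lambda>v. (q' v \<oplus> r' v) \<odot>\<^bsub>M\<^esub> v) (S \<union> T)"
      using BM by (intro finsum_cong') (auto simp: smult_l_distr)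
    finally show ?thesis
      unfolding linear_span_def using S T
      by (intro CollectI exI[of _ "\<lambda>v. q' v \<oplus> r' v"] exI[of _ "S \<union> T"]) auto
  qed
qed

end

section \<open>Products in linear spans\<close>

context algebra
begin

text \<open>Multiplication by x is linear, so the preimage of a submodule is a submodule. Together
  with minimality of the span, this reduces a product with an arbitrary element of a span to
  products with generators.\<close>

lemma submodule_mult_preimage:
  assumes "submodule N R M" "x \<in> carrier M"
  shows "submodule {y \<in> carrier M. x \<otimes>\<^bsub>M\<^esub> y \<in> N} R M"
proof -
  interpret N: submodule N R M by fact
  note N = submoduleE[OF assms(1)]
  show ?thesis
  proof (rule submoduleI)
    show "{y \<in> carrier M. x \<otimes>\<^bsub>M\<^esub> y \<in> N} \<subseteq> carrier M" by blast
    show "\<zero>\<^bsub>M\<^esub> \<in> {y \<in> carrier M. x \<otimes>\<^bsub>M\<^esub> y \<in> N}"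
      using N.one_closed assms(2) by simp
    show "\<ominus>\<^bsub>M\<^esub> a \<in> {y \<in> carrier M. x \<otimes>\<^bsub>M\<^esub> y \<in> N}"
      if "a \<in> {y \<in> carrier M. x \<otimes>\<^bsub>M\<^esub> y \<in> N}" for a
      using that assms(2) N(3) by (simp add: r_minus)
    show "a \<oplus>\<^bsub>M\<^esub> b \<in> {y \<in> carrier M. x \<otimes>\<^bsub>M\<^esub> y \<in> N}"
      if "a \<in> {y \<in> carrier M. x \<otimes>\<^bsub>M\<^esub> y \<in> N}" "b \<in> {y \<in> carrier M. x \<otimes>\<^bsub>M\<^esub> y \<in> N}" for a b
      using that assms(2) N(5) by (simp add: r_distr)
    show "a \<odot>\<^bsub>M\<^esub> y \<in> {y \<in> carrier M. x \<otimes>\<^bsub>M\<^esub> y \<in> N}"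
      if "a \<in> carrier R" "y \<in> {y \<in> carrier M. x \<otimes>\<^bsub>M\<^esub> y \<in> N}" for a y
    proof -
      \<comment> \<open>The algebra axiom takes scalars out of the left factor only, hence the two
        commutations.\<close>
      have "x \<otimes>\<^bsub>M\<^esub> (a \<odot>\<^bsub>M\<^esub> y) = (a \<odot>\<^bsub>M\<^esub> y) \<otimes>\<^bsub>M\<^esub> x"
        using that assms(2) by (intro m_comm) auto
      also have "\<dots> = a \<odot>\<^bsub>M\<^esub> (y \<otimes>\<^bsub>M\<^esub> x)"
        using that assms(2) by (intro smult_assoc2) auto
      also have "y \<otimes>\<^bsub>M\<^esub> x = x \<otimes>\<^bsub>M\<^esub> y"
        using that assms(2) by (intro m_comm) auto
      finally show ?thesis using that N(4) by simp
    qed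
  qed
qed

text \<open>Bilinear extension, one factor at a time: first a generator times y, then, after
  commuting, y times x.\<close>

lemma linear_span_mult_closed:
  assumes B: "B \<subseteq> carrier M"
    and mult: "\<And>u v. \<lbrakk>u \<in> B; v \<in> B\<rbrakk> \<Longrightarrow> u \<otimes>\<^bsub>M\<^esub> v \<in> linear_span R M B"
    and xy: "x \<in> linear_span R M B" "y \<in> linear_span R M B"
  shows "x \<otimes>\<^bsub>M\<^esub> y \<in> linear_span R M B"
proof -
  let ?L = "linear_span R M B"
  note sub = submodule_linear_span[OF B]
  have L: "?L \<subseteq> carrier M" using submoduleE(1)[OF sub] .
  have comm: "u \<otimes>\<^bsub>M\<^esub> z = z \<otimes>\<^bsub>M\<^esub> u" if "u \<in> ?L" "z \<in> ?L" for u z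
    using that L by (intro m_comm) auto
  have extend: "u \<otimes>\<^bsub>M\<^esub> z \<in> ?L"
    if "u \<in> ?L" "z \<in> ?L" "\<And>v. v \<in> B \<Longrightarrow> u \<otimes>\<^bsub>M\<^esub> v \<in> ?L" for u z
    using linear_span_subset_submodule[OF submodule_mult_preimage[OF sub, of u], of B] B L that
    by blast
  have BL: "v \<in> ?L" if "v \<in> B" for v using linear_span_memI[OF B that] .
  have "u \<otimes>\<^bsub>M\<^esub> y \<in> ?L" if "u \<in> B" for u
    using extend[OF BL[OF that] xy(2)] mult that by blast
  then have "y \<otimes>\<^bsub>M\<^esub> u \<in> ?L" if "u \<in> B" for u
    using comm[OF xy(2) BL[OF that]] that by simp
  then have "y \<otimes>\<^bsub>M\<^esub> x \<in> ?L" by (rule extend[OF xy(2,1)])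
  then show ?thesis using comm[OF xy] by simp
qed

end

section \<open>The algebra of rational functions on a set\<close>

lemma algebra_fun_algebra: "algebra rat_field (fun_algebra D)"
proof (rule algebraI)
  show "cring rat_field" by (rule cring_from_type_algebra)
  show "cring (fun_algebra D)"
  proof (rule cringI)
    show "abelian_group (fun_algebra D)"
    proof (rule abelian_groupI)
      fix f assume "f \<in> carrier (fun_algebra D)"
      then show "\<exists>g\<in>carrier (fun_algebra D). g \<oplus>\<^bsub>fun_algebra D\<^esub> f = \<zero>\<^bsub>fun_algebra D\<^esub>"
        by (intro bexI[of _ "\<lambda>x\<in>D. - f x"]) (auto simp: fun_algebra_def)
    qed (auto simp: fun_algebra_def PiE_def extensional_def restrict_def fun_eq_iff)
    show "comm_monoid (fun_algebra D)"
      by (rule comm_monoidI)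
        (auto simp: fun_algebra_def PiE_def extensional_def restrict_def fun_eq_iff)
  qed (auto simp: fun_algebra_def algebra_simps intro!: restrict_ext)
qed (simp_all add: fun_algebra_def ring_of_type_algebra_def algebra_simps
       cong: restrict_cong)

lemma finsum_fun_algebra:
  assumes "finite S" "f \<in> S \<rightarrow> carrier (fun_algebra D)"
  shows "finsum (fun_algebra D) f S = (\<lambda>x\<in>D. \<Sum>s\<in>S. f s x)"
proof -
  interpret algebra rat_field "fun_algebra D" by (rule algebra_fun_algebra)
  show ?thesis using assms
  proof (induction S rule: finite_induct)
    case empty
    have "finsum (fun_algebra D) f {} = \<zero>\<^bsub>fun_algebra D\<^esub>" by (rule finsum_empty)
    then show ?case by (simp add: fun_algebra_def)
  next
    case (insert s S)
    then have "finsum (fun_algebra D) f (insert s S)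
        = f s \<oplus>\<^bsub>fun_algebra D\<^esub> finsum (fun_algebra D) f S" by simp
    then show ?case using insert by (auto simp: fun_algebra_def intro!: restrict_ext)
  qed
qed

section \<open>Restrictions and isomorphism classes of objects\<close>

context combinatorial_presheaf
begin

text \<open>Functoriality applied to a composite of two inclusions.\<close>

lemma restr_restr:
  assumes "d \<in> objects h" "K \<subseteq> fst d" "J \<subseteq> K"
  shows "restr h (restr h d K) J = restr h d J"
proof -
  have "finite (fst d)" "snd d \<in> ob h (fst d)" using assms(1) by (auto simp: objects_def)
  moreover from this have "finite K" using assms(2) by (blast intro: finite_subset)
  moreover from this have "finite J" using assms(3) by (blast intro: finite_subset)
  ultimately have fin: "finite (fst d)" "finite K" "finite J" "snd d \<in> ob h (fst d)" by auto
  have "mor h J K (\<lambda>j\<in>J. j) (mor h K (fst d) (\<lambda>j\<in>K. j) (snd d))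
      = mor h J (fst d) (compose J (\<lambda>j\<in>K. j) (\<lambda>j\<in>J. j)) (snd d)"
    using fin assms by (intro mor_comp[symmetric] inclusion_in_injections) auto
  also have "compose J (\<lambda>j\<in>K. j) (\<lambda>j\<in>J. j) = (\<lambda>j\<in>J. j)"
    using assms(3) by (auto simp: compose_def intro!: restrict_ext)
  finally show ?thesis by (simp only: restr_def fst_conv snd_conv)
qed

lemma iso_imp_card_eq: "iso_objects h a b \<Longrightarrow> card (fst a) = card (fst b)"
  by (auto simp: iso_objects_def dest: bij_betw_same_card)

lemma rep_in_objects: "A \<in> coinvariants h \<Longrightarrow> rep A \<in> objects h"
  using class_members(1) rep_in by blast

lemma rep_on:
  assumes "A \<in> coinvariants h"
  obtains n where "A \<in> objects_on h n // iso_rel h n" "rep A \<in> objects_on h n"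
    "card (fst (rep A)) = n"
proof -
  obtain n where n: "A \<in> objects_on h n // iso_rel h n"
    using assms by (auto simp: coinvariants_def)
  have "rep A \<in> objects_on h n"
    using in_quotient_imp_subset[OF equiv_iso_rel n] rep_in[OF assms] by blast
  then show ?thesis using that[OF n] by (auto simp: objects_on_def)
qed

text \<open>Isomorphic objects have underlying sets of equal size, so both classes belong to the
  same quotient, where isomorphism is the defining equivalence.\<close>

lemma coinvariants_eqI:
  assumes "A \<in> coinvariants h" "B \<in> coinvariants h" "iso_objects h (rep A) (rep B)"
  shows "A = B"
proof -
  obtain n where n: "A \<in> objects_on h n // iso_rel h n" "rep A \<in> objects_on h n"
    "card (fst (rep A)) = n" by (rule rep_on[OF assms(1)])
  obtain m where m: "B \<in> objects_on h m // iso_rel h m" "rep B \<in> objects_on h m"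
    "card (fst (rep B)) = m" by (rule rep_on[OF assms(2)])
  have "m = n" using n m iso_imp_card_eq[OF assms(3)] by simp
  then have "(rep A, rep B) \<in> iso_rel h n" using n m assms(3) by (simp add: iso_rel_def)
  then show ?thesis
    using quotient_eq_iff[OF equiv_iso_rel n(1)] m(1) \<open>m = n\<close> rep_in assms(1,2) by blast
qed

text \<open>Numbering the underlying set transports x to an object on \<open>{1..n}\<close>, which
  does lie in a class.\<close>

lemma iso_to_rep_exists:
  assumes "x \<in> objects h"
  shows "\<exists>C\<in>coinvariants h. iso_objects h x (rep C)"
proof -
  define n where "n = card (fst x)"
  have fin: "finite (fst x)" "snd x \<in> ob h (fst x)" using assms by (auto simp: objects_def)
  obtain g where g: "bij_betw g {1..n} (fst x)"
    using ex_bij_betw_nat_finite_1[OF fin(1)] unfolding n_def by blast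
  \<comment> \<open>Morphisms are extensional functions, so the numbering has to be cut down to
    \<open>{1..n}\<close>.\<close>
  define f where "f = restrict g {1..n}"
  have fb: "bij_betw f {1..n} (fst x)"
    unfolding f_def using g by (subst bij_betw_restrict_eq)
  have fE: "f \<in> {1..n} \<rightarrow>\<^sub>E fst x"
    unfolding f_def using bij_betw_imp_funcset[OF g] by (simp add: restrict_PiE_iff Pi_iff)
  define y where "y = ({1..n}, mor h {1..n} (fst x) f (snd x))"
  have y: "y \<in> objects_on h n"
    using mor_closed[of "fst x" "{1..n}" f "snd x"] fin fE fb
    by (simp add: y_def objects_on_def injections_def bij_betw_def)
  have yx: "iso_objects h y x" using fE fb by (auto simp: iso_objects_def y_def)
  define C where "C = iso_rel h n `` {y}"
  have "C \<in> objects_on h n // iso_rel h n" using y by (simp add: C_def quotientI)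
  then have C: "C \<in> coinvariants h" by (auto simp: coinvariants_def)
  have "y \<in> C" using equiv_class_self[OF equiv_iso_rel y] by (simp add: C_def)
  note yC = class_members[OF C this rep_in[OF C]]
  have "iso_objects h x (rep C)"
    using iso_trans[OF assms yC(1,2) iso_sym[OF yC(1) assms yx] yC(3)] .
  with C show ?thesis by blast
qed

text \<open>The point of the coinvariants determined by x. In general x is not a member of it, since
  classes contain only objects on sets \<open>{1..n}\<close> while restrictions live on arbitrary
  finite sets.\<close>

definition iso_class :: "'a object \<Rightarrow> 'a object set" where
  "iso_class x = (SOME C. C \<in> coinvariants h \<and> iso_objects h x (rep C))"

lemma iso_class:
  assumes "x \<in> objects h"
  shows "iso_class x \<in> coinvariants h" "iso_objects h x (rep (iso_class x))"
  using someI_ex[OF iso_to_rep_exists[OF assms, unfolded Bex_def]] by (auto simp: iso_class_def)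

text \<open>Turns isomorphism with a representative into an equation, so that subsets can be sorted
  as fibres of a map.\<close>

lemma iso_rep_iff:
  assumes "x \<in> objects h" "C \<in> coinvariants h"
  shows "iso_objects h x (rep C) \<longleftrightarrow> C = iso_class x"
proof
  assume "iso_objects h x (rep C)"
  note rep_objects = rep_in_objects[OF assms(2)] rep_in_objects[OF iso_class(1)[OF assms(1)]]
  have "iso_objects h (rep C) x"
    by (rule iso_sym[OF assms(1) rep_objects(1) \<open>iso_objects h x (rep C)\<close>])
  then have "iso_objects h (rep C) (rep (iso_class x))"
    by (rule iso_trans[OF rep_objects(1) assms(1) rep_objects(2) _ iso_class(2)[OF assms(1)]])
  then show "C = iso_class x" by (rule coinvariants_eqI[OF assms(2) iso_class(1)[OF assms(1)]])
qed (use iso_class assms in simp)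

lemma pattern_count_rep:
  assumes "C \<in> coinvariants h" "d \<in> objects h"
  shows "pattern_count h (rep C) d = card {K \<in> Pow (fst d). iso_class (restr h d K) = C}"
proof -
  have "iso_objects h (restr h d K) (rep C) \<longleftrightarrow> iso_class (restr h d K) = C" if "K \<subseteq> fst d" for K
    using iso_rep_iff[OF restr_in_objects[OF assms(2) that] assms(1)] by blast
  then show ?thesis
    unfolding pattern_count_def by (intro arg_cong[where f = card]) auto
qed

section \<open>Counting pairs of occurrences\<close>

text \<open>A pair of occurrences of \<open>a\<close> and \<open>b\<close> in \<open>d\<close>, on \<open>I\<close> and \<open>J\<close>, is a quasi-shuffle of \<open>a\<close> and \<open>b\<close>
  in the restriction of \<open>d\<close> to \<open>I \<union> J\<close>.\<close>

lemma pattern_count_mult: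
  assumes d: "d \<in> objects h"
  shows "pattern_count h a d * pattern_count h b d
    = (\<Sum>K\<in>Pow (fst d). quasi_shuffle h (restr h d K) a b)"
proof -
  let ?P = "\<lambda>c. {J. J \<subseteq> fst d \<and> iso_objects h (restr h d J) c}"
  let ?Q = "\<lambda>K. {(I, J). I \<union> J = K \<and> iso_objects h (restr h d I) a \<and> iso_objects h (restr h d J) b}"
  have fin: "finite (fst d)" using d by (auto simp: objects_def)
  have "finite (?P a \<times> ?P b)" using fin by simp
  \<comment> \<open>Each pair belongs to exactly one block, the one indexed by its union.\<close>
  have Q: "?P a \<times> ?P b = (\<Union>K\<in>Pow (fst d). ?Q K)" by auto
  have finQ: "finite (?Q K)" if "K \<in> Pow (fst d)" for K
    using that by (intro finite_subset[OF _ \<open>finite (?P a \<times> ?P b)\<close>]) auto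
  have "pattern_count h a d * pattern_count h b d = card (?P a \<times> ?P b)"
    by (simp add: pattern_count_def card_cartesian_product)
  also have "\<dots> = (\<Sum>K\<in>Pow (fst d). card (?Q K))"
    unfolding Q using fin finQ by (intro card_UN_disjoint) auto
  also have "\<dots> = (\<Sum>K\<in>Pow (fst d). quasi_shuffle h (restr h d K) a b)"
  proof (rule sum.cong[OF refl])
    fix K assume K: "K \<in> Pow (fst d)"
    have twice: "restr h (restr h d K) I = restr h d I" if "I \<subseteq> K" for I
      using restr_restr[OF d] K that by simp
    have "I \<union> J = K \<and> iso_objects h (restr h d I) a \<and> iso_objects h (restr h d J) b \<longleftrightarrow>
        I \<union> J = K \<and> iso_objects h (restr h (restr h d K) I) a \<and> iso_objects h (restr h (restr h d K) J) b"
      for I J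
      using twice[of I] twice[of J] by (metis Un_upper1 Un_upper2)
    then show "card (?Q K) = quasi_shuffle h (restr h d K) a b"
      by (simp add: quasi_shuffle_def restr_def[of h d K])
  qed
  finally show ?thesis .
qed

text \<open>The index set \<open>F\<close> is any finite set of classes containing all nonzero
  terms. This serves both the sum over the nonzero terms at one argument and a sum with one index
  set for all arguments.\<close>

lemma quasi_shuffle_product_count:
  assumes A: "A \<in> coinvariants h" and B: "B \<in> coinvariants h" and d: "d \<in> objects h"
    and F: "finite F" "F \<subseteq> coinvariants h"
    and cover: "\<And>C. \<lbrakk>C \<in> coinvariants h; quasi_shuffle_class h C A B \<noteq> 0;
      pattern_count h (rep C) d \<noteq> 0\<rbrakk> \<Longrightarrow> C \<in> F"
  shows "pattern_count h (rep A) d * pattern_count h (rep B) d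
    = (\<Sum>C\<in>F. quasi_shuffle_class h C A B * pattern_count h (rep C) d)"
proof -
  let ?qs = "\<lambda>C. quasi_shuffle_class h C A B"
  let ?cl = "\<lambda>K. iso_class (restr h d K)"
  let ?G = "?cl ` Pow (fst d)"
  have fin: "finite (Pow (fst d))" using d by (auto simp: objects_def)
  have cl: "?cl K \<in> coinvariants h" "iso_objects h (restr h d K) (rep (?cl K))"
    "restr h d K \<in> objects h" if "K \<in> Pow (fst d)" for K
    using iso_class restr_in_objects[OF d] that by auto
  have G: "?G \<subseteq> coinvariants h" using cl by auto
  have "pattern_count h (rep A) d * pattern_count h (rep B) d
      = (\<Sum>K\<in>Pow (fst d). quasi_shuffle h (restr h d K) (rep A) (rep B))"
    by (rule pattern_count_mult[OF d])
  also have "\<dots> = (\<Sum>K\<in>Pow (fst d). ?qs (?cl K))"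
    unfolding quasi_shuffle_class_def using A B cl
    by (intro sum.cong refl quasi_shuffle_cong iso_refl rep_in_objects) auto
  \<comment> \<open>On the fibre over C the summand is constant, and the fibre has
    \<open>pattern_count h (rep C) d\<close> elements.\<close>
  also have "\<dots> = (\<Sum>C\<in>?G. \<Sum>K\<in>{K \<in> Pow (fst d). ?cl K = C}. ?qs (?cl K))"
    by (rule sum.image_gen[OF fin])
  also have "\<dots> = (\<Sum>C\<in>?G. ?qs C * pattern_count h (rep C) d)"
    using G by (intro sum.cong) (auto simp: pattern_count_rep[OF _ d] subset_iff)
  \<comment> \<open>The passage from \<open>?G\<close> to \<open>F\<close> goes through their union:
    classes outside \<open>?G\<close> do not occur in d, and terms outside \<open>F\<close> vanish
    by \<open>cover\<close>.\<close>
  also have "\<dots> = (\<Sum>C\<in>?G \<union> F. ?qs C * pattern_count h (rep C) d)"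
  proof (intro sum.mono_neutral_left ballI)
    fix C assume C: "C \<in> ?G \<union> F - ?G"
    then have "{K \<in> Pow (fst d). ?cl K = C} = {}" by auto
    moreover have "C \<in> coinvariants h" using C F by auto
    ultimately show "?qs C * pattern_count h (rep C) d = 0"
      using pattern_count_rep[OF _ d, of C] by (metis card.empty mult_0_right)
  qed (use fin F in auto)
  also have "\<dots> = (\<Sum>C\<in>F. ?qs C * pattern_count h (rep C) d)"
  proof (intro sum.mono_neutral_right ballI)
    fix C assume C: "C \<in> ?G \<union> F - F"
    then have "C \<in> coinvariants h" using G by auto
    then show "?qs C * pattern_count h (rep C) d = 0" using cover C by auto
  qed (use fin F in auto)
  finally show ?thesis .
qed

section \<open>Finiteness of the quasi-shuffle support\<close>

lemma finite_coinvariants_bounded: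
  "finite {C \<in> coinvariants h. card (fst (rep C)) \<le> N}"
proof (rule finite_subset)
  show "{C \<in> coinvariants h. card (fst (rep C)) \<le> N} \<subseteq> (\<Union>n\<le>N. objects_on h n // iso_rel h n)"
    by (auto elim!: rep_on)
  have "finite (objects_on h n // iso_rel h n)" for n
  proof (rule finite_quotient)
    show "iso_rel h n \<subseteq> objects_on h n \<times> objects_on h n" by (auto simp: iso_rel_def)
    show "finite (objects_on h n)" using finite_ob by (simp add: objects_on_def)
  qed
  then show "finite (\<Union>n\<le>N. objects_on h n // iso_rel h n)" by simp
qed

text \<open>A quasi-shuffle is covered by two sets of the sizes of A and B, so its size is at most
  their sum.\<close>

lemma finite_quasi_shuffle_support:
  "finite {C \<in> coinvariants h. quasi_shuffle_class h C A B \<noteq> 0}"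
proof (rule finite_subset[OF _ finite_coinvariants_bounded])
  show "{C \<in> coinvariants h. quasi_shuffle_class h C A B \<noteq> 0}
    \<subseteq> {C \<in> coinvariants h. card (fst (rep C)) \<le> card (fst (rep A)) + card (fst (rep B))}"
  proof safe
    fix C assume "0 < quasi_shuffle_class h C A B"
    then obtain I J where IJ: "I \<union> J = fst (rep C)"
      "iso_objects h (restr h (rep C) I) (rep A)" "iso_objects h (restr h (rep C) J) (rep B)"
      unfolding quasi_shuffle_class_def quasi_shuffle_def
      by (force simp: card_gt_0_iff)
    have "card I = card (fst (rep A))" "card J = card (fst (rep B))"
      using IJ(2,3)[THEN iso_imp_card_eq] by (simp_all add: restr_def)
    then show "card (fst (rep C)) \<le> card (fst (rep A)) + card (fst (rep B))"
      using card_Un_le[of I J] IJ(1) by simp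
  qed
qed

section \<open>Products of pattern functions\<close>

lemma pattern_fun_mult:
  assumes "A \<in> coinvariants h" "B \<in> coinvariants h" "D \<in> coinvariants h"
    and "finite F" "F \<subseteq> coinvariants h"
    and "\<And>C. \<lbrakk>C \<in> coinvariants h; of_nat (quasi_shuffle_class h C A B) * pattern_fun h C D \<noteq> 0\<rbrakk>
      \<Longrightarrow> C \<in> F"
  shows "pattern_fun h A D * pattern_fun h B D
    = (\<Sum>C\<in>F. of_nat (quasi_shuffle_class h C A B) * pattern_fun h C D)"
proof -
  have "pattern_count h (rep A) (rep D) * pattern_count h (rep B) (rep D)
    = (\<Sum>C\<in>F. quasi_shuffle_class h C A B * pattern_count h (rep C) (rep D))"
    using assms by (intro quasi_shuffle_product_count rep_in_objects) (auto simp: pattern_fun_def)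
  from arg_cong[OF this, of "of_nat :: nat \<Rightarrow> rat"] show ?thesis
    using assms(3) by (simp add: pattern_fun_def)
qed

lemma pattern_fun_in_carrier: "pattern_fun h A \<in> carrier (fun_algebra (coinvariants h))"
  by (auto simp: pattern_fun_def fun_algebra_def)

text \<open>Here \<open>?F\<close> is the full quasi-shuffle support, which does not depend on D;
  this makes the pointwise formula a single linear combination of pattern functions.\<close>

lemma pattern_fun_mult_in_algebra:
  assumes "A \<in> coinvariants h" "B \<in> coinvariants h"
  shows "pattern_fun h A \<otimes>\<^bsub>fun_algebra (coinvariants h)\<^esub> pattern_fun h B \<in> pattern_algebra h"
proof -
  let ?M = "fun_algebra (coinvariants h)" and ?B = "pattern_fun h ` coinvariants h"
  let ?F = "{C \<in> coinvariants h. quasi_shuffle_class h C A B \<noteq> 0}"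
  let ?t = "\<lambda>C. of_nat (quasi_shuffle_class h C A B) \<odot>\<^bsub>?M\<^esub> pattern_fun h C"
  interpret M: algebra rat_field ?M by (rule algebra_fun_algebra)
  have B: "?B \<subseteq> carrier ?M" using pattern_fun_in_carrier by auto
  have sub: "submodule (pattern_algebra h) rat_field ?M"
    unfolding pattern_algebra_def by (rule M.submodule_linear_span[OF B])
  have gen: "pattern_fun h C \<in> pattern_algebra h" if "C \<in> coinvariants h" for C
    unfolding pattern_algebra_def using that by (intro M.linear_span_memI[OF B]) auto
  have t: "?t C \<in> pattern_algebra h" if "C \<in> ?F" for C
    using that gen by (intro M.submoduleE(4)[OF sub]) (auto simp: ring_of_type_algebra_def)
  have "pattern_fun h A \<otimes>\<^bsub>?M\<^esub> pattern_fun h B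
    = (\<lambda>D\<in>coinvariants h. pattern_fun h A D * pattern_fun h B D)"
    by (simp add: fun_algebra_def)
  also have "\<dots> = (\<lambda>D\<in>coinvariants h. \<Sum>C\<in>?F. of_nat (quasi_shuffle_class h C A B) * pattern_fun h C D)"
    using assms finite_quasi_shuffle_support by (intro restrict_ext pattern_fun_mult) auto
  also have "\<dots> = (\<lambda>D\<in>coinvariants h. \<Sum>C\<in>?F. ?t C D)"
    by (intro restrict_ext sum.cong) (auto simp: fun_algebra_def)
  also have "\<dots> = finsum ?M ?t ?F"
    using t M.submoduleE(1)[OF sub] finite_quasi_shuffle_support
    by (intro finsum_fun_algebra[symmetric]) auto
  also have "\<dots> \<in> pattern_algebra h"
    using t finite_quasi_shuffle_support
    by (intro submodule_finsum_closed[OF M.module_axioms sub]) auto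
  finally show ?thesis .
qed

section \<open>The unit\<close>

lemma empty_class:
  assumes "c \<in> ob h {}"
  shows "empty_class h c \<in> coinvariants h" "({}, c) \<in> empty_class h c"
proof -
  have c: "({}, c) \<in> objects_on h 0" using assms by (simp add: objects_on_def)
  then have "empty_class h c \<in> objects_on h 0 // iso_rel h 0"
    by (simp add: empty_class_def quotientI)
  then show "empty_class h c \<in> coinvariants h" by (auto simp: coinvariants_def)
  show "({}, c) \<in> empty_class h c"
    using equiv_class_self[OF equiv_iso_rel c] by (simp add: empty_class_def)
qed

lemma iso_empty_iff:
  assumes "c \<in> ob h {}"
  shows "iso_objects h (J, x) ({}, c) \<longleftrightarrow> J = {} \<and> x = c"
proof -
  \<comment> \<open>The only extensional function on the empty set is constantly
    \<open>undefined\<close>; it is the identity there, so isomorphism over the empty set is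
    equality.\<close>
  have "mor h {} {} (\<lambda>_. undefined) c = c" using mor_id[of "{}" c] assms by (simp add: restrict_def)
  then show ?thesis by (auto simp: iso_objects_def bij_betw_def)
qed

text \<open>Every object has exactly one restriction to the empty set.\<close>

lemma sum_pattern_count_empty:
  assumes "d \<in> objects h"
  shows "(\<Sum>c\<in>ob h {}. pattern_count h ({}, c) d) = 1"
proof -
  define c0 where "c0 = snd (restr h d {})"
  have c0: "c0 \<in> ob h {}"
    using restr_in_objects[OF assms, of "{}"] by (auto simp: c0_def objects_def restr_def)
  have "pattern_count h ({}, c) d = (if c = c0 then 1 else 0)" if "c \<in> ob h {}" for c
  proof -
    have "iso_objects h (restr h d J) ({}, c) \<longleftrightarrow> J = {} \<and> c = c0" for J
      using iso_empty_iff[OF that] by (auto simp: restr_def c0_def)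
    then have "{J. J \<subseteq> fst d \<and> iso_objects h (restr h d J) ({}, c)} = (if c = c0 then {{}} else {})"
      by auto
    then show ?thesis by (simp add: pattern_count_def)
  qed
  then show ?thesis using c0 finite_ob[of "{}"] by simp
qed

text \<open>At each argument exactly one summand is 1 and the others are 0, because the argument has
  a single restriction to the empty set.\<close>

lemma one_eq_sum_empty_class:
  "\<one>\<^bsub>fun_algebra (coinvariants h)\<^esub> =
    (\<Oplus>\<^bsub>fun_algebra (coinvariants h)\<^esub> c \<in> ob h {}. pattern_fun h (empty_class h c))"
proof -
  have "(\<Sum>c\<in>ob h {}. pattern_fun h (empty_class h c) D) = 1" if D: "D \<in> coinvariants h" for D
  proof -
    have "(\<Sum>c\<in>ob h {}. pattern_fun h (empty_class h c) D)
        = (\<Sum>c\<in>ob h {}. of_nat (pattern_count h ({}, c) (rep D)))"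
      using empty_class D rep_in by (intro sum.cong refl pattern_fun_eq) auto
    also have "\<dots> = of_nat (\<Sum>c\<in>ob h {}. pattern_count h ({}, c) (rep D))" by simp
    also have "\<dots> = 1" using sum_pattern_count_empty[OF rep_in_objects[OF D]] by simp
    finally show ?thesis .
  qed
  then have "(\<lambda>D\<in>coinvariants h. 1) = (\<lambda>D\<in>coinvariants h. \<Sum>c\<in>ob h {}. pattern_fun h (empty_class h c) D)"
    by (intro restrict_ext) simp
  then show ?thesis
    using finite_ob[of "{}"] pattern_fun_in_carrier
    by (subst finsum_fun_algebra) (auto simp: fun_algebra_def)
qed

section \<open>The subalgebra and the product formula\<close>

lemma unital_subalgebra_pattern_algebra:
  "unital_subalgebra (pattern_algebra h) rat_field (fun_algebra (coinvariants h))"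
proof -
  let ?M = "fun_algebra (coinvariants h)" and ?B = "pattern_fun h ` coinvariants h"
  interpret M: algebra rat_field ?M by (rule algebra_fun_algebra)
  have B: "?B \<subseteq> carrier ?M" using pattern_fun_in_carrier by auto
  have sub: "submodule (pattern_algebra h) rat_field ?M"
    unfolding pattern_algebra_def by (rule M.submodule_linear_span[OF B])
  have "subring (pattern_algebra h) ?M"
  proof (rule ring.subringI)
    show "ring ?M" by (rule M.ring_axioms)
    show "pattern_algebra h \<subseteq> carrier ?M" by (rule M.submoduleE(1)[OF sub])
    show "\<one>\<^bsub>?M\<^esub> \<in> pattern_algebra h"
      unfolding one_eq_sum_empty_class
    proof (rule submodule_finsum_closed[OF M.module_axioms sub])
      show "finite (ob h {})" using finite_ob by simp
      show "(\<lambda>c. pattern_fun h (empty_class h c)) \<in> ob h {} \<rightarrow> pattern_algebra h"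
        unfolding pattern_algebra_def using empty_class(1) M.linear_span_memI[OF B] by auto
    qed
    show "\<ominus>\<^bsub>?M\<^esub> x \<in> pattern_algebra h" if "x \<in> pattern_algebra h" for x
      using M.submoduleE(3)[OF sub] that by simp
    show "x \<oplus>\<^bsub>?M\<^esub> y \<in> pattern_algebra h" if "x \<in> pattern_algebra h" "y \<in> pattern_algebra h" for x y
      using M.submoduleE(5)[OF sub] that by simp
    show "x \<otimes>\<^bsub>?M\<^esub> y \<in> pattern_algebra h" if "x \<in> pattern_algebra h" "y \<in> pattern_algebra h" for x y
      using that pattern_fun_mult_in_algebra unfolding pattern_algebra_def
      by - (rule M.linear_span_mult_closed[OF B], auto)
  qed
  with sub M.algebra_axioms show ?thesis by (simp add: unital_subalgebra_def)
qed

end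

theorem mainTheorem2:
  fixes h :: "'a presheaf"
  assumes "combinatorial_presheaf h"
  shows "(\<forall>a \<in> coinvariants h. \<forall>b \<in> coinvariants h.
            (\<forall>d \<in> coinvariants h.
               finite {c \<in> coinvariants h. of_nat (quasi_shuffle_class h c a b) * pattern_fun h c d \<noteq> 0}) \<and>
            pattern_fun h a \<otimes>\<^bsub>fun_algebra (coinvariants h)\<^esub> pattern_fun h b =
              (\<lambda>d \<in> coinvariants h.
                 \<Sum>c \<in> {c \<in> coinvariants h. of_nat (quasi_shuffle_class h c a b) * pattern_fun h c d \<noteq> 0}.
                   of_nat (quasi_shuffle_class h c a b) * pattern_fun h c d)) \<and>
         unital_subalgebra (pattern_algebra h) rat_field (fun_algebra (coinvariants h)) \<and>
         \<one>\<^bsub>fun_algebra (coinvariants h)\<^esub> =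
           (\<Oplus>\<^bsub>fun_algebra (coinvariants h)\<^esub> c \<in> ob h {}. pattern_fun h (empty_class h c))"
proof -
  interpret combinatorial_presheaf h by fact
  let ?F = "\<lambda>a b d. {c \<in> coinvariants h. of_nat (quasi_shuffle_class h c a b) * pattern_fun h c d \<noteq> 0}"
  \<comment> \<open>The nonzero terms at any argument lie in the finite quasi-shuffle
    support.\<close>
  have fin: "finite (?F a b d)" for a b d
    by (rule finite_subset[OF _ finite_quasi_shuffle_support[of a b]]) auto
  have "pattern_fun h a \<otimes>\<^bsub>fun_algebra (coinvariants h)\<^esub> pattern_fun h b =
      (\<lambda>d \<in> coinvariants h. \<Sum>c \<in> ?F a b d. of_nat (quasi_shuffle_class h c a b) * pattern_fun h c d)"
    if "a \<in> coinvariants h" "b \<in> coinvariants h" for a b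
  proof -
    have "(\<lambda>d \<in> coinvariants h. pattern_fun h a d * pattern_fun h b d) =
      (\<lambda>d \<in> coinvariants h. \<Sum>c \<in> ?F a b d. of_nat (quasi_shuffle_class h c a b) * pattern_fun h c d)"
      using that fin by (intro restrict_ext pattern_fun_mult) auto
    then show ?thesis by (simp add: fun_algebra_def)
  qed
  with fin unital_subalgebra_pattern_algebra one_eq_sum_empty_class show ?thesis by blast
qed

end
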